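(* Let $X$ be a finite-dimensional real normed linear space, $\Omega\subseteq X$ a nonempty closed set, $v\in X$ nonzero, $T(x):=\inf\{t\ge 0\mid x+tv\in\Omega\}$, and let $\bar x\in\operatorname{dom}T$. Let $N$ denote the limiting (Mordukhovich) normal cone. (1) Assume that $\bar x\in\Omega$. Then $T$ is Lipschitz continuous around $\bar x$ if and only if $\{v\}^+\cap N(\bar x;\Omega)=\{0\}$. (2) Assume that $\bar x\notin\Omega$ and set $\tilde x:=\bar x+T(\bar x)v$. If $\{v\}^+\cap N(\tilde x;\Omega)=\{0\}$, then $T$ is Lipschitz continuous around $\bar x$. The converse holds true if $v\in\Omega_\infty$.
   Context: $T$ takes values in $[0,\infty]$ with $\inf\emptyset=\infty$, and $\operatorname{dom}T:=\{x\mid T(x)<\infty\}$; for $x\in\operatorname{dom}T$ the point $x+T(x)v$ lies in $\Omega$. $X^*$ is the dual of $X$ and $\{v\}^+:=\{x^*\in X^*\mid\langle x^*,v\rangle\ge0\}$. The Fréchet normal cone $\widehat N(y;\Omega)$ at $y\in\Omega$ is the set of $x^*\in X^*$ such that for every $\varepsilon>0$ there is $\delta>0$ with $\langle x^*,x-y\rangle\le\varepsilon\|x-y\|$ for all $x\in\Omega$ with $\|x-y\|\le\delta$. The limiting normal cone $N(y;\Omega)$ is the set of $x^*\in X^*$ for which there are sequences $x_k\to y$ with $x_k\in\Omega$, and $x_k^*\in\widehat N(x_k;\Omega)$ with $x_k^*\to x^*$. $T$ is Lipschitz continuous around $\bar x$ if there are $\ell\ge0$ and a neighborhood of $\bar x$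 on which $T$ is finite and satisfies $|T(x)-T(y)|\le\ell\|x-y\|$. The recession cone is $\Omega_\infty:=\{u\in X\mid\omega+\lambda u\in\Omega\text{ for all }\omega\in\Omega,\ \lambda\ge0\}$. *)

theory Defs
  imports "HOL-Analysis.Analysis"
begin

definition finite_dimensional :: "'a::real_vector itself \<Rightarrow> bool" where
  "finite_dimensional _ \<longleftrightarrow> (\<exists>B::'a set. finite B \<and> span B = UNIV)"

text \<open>
  In \<^typ>\<open>ereal\<close> the infimum of the empty set is \<open>\<infinity>\<close>, so the function takes values in \<open>[0, \<infinity>]\<close>.
\<close>

definition min_time :: "'a::real_vector set \<Rightarrow> 'a \<Rightarrow> 'a \<Rightarrow> ereal" where
  "min_time \<Omega> v x = Inf {ereal t | t. 0 \<le> t \<and> x + t *\<^sub>R v \<in> \<Omega>}"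

definition eff_dom :: "('a \<Rightarrow> ereal) \<Rightarrow> 'a set" where
  "eff_dom f = {x. f x < \<infinity>}"

text \<open>The dual space is the type of bounded linear functionals, with the operator norm.\<close>

type_synonym 'a dual = "'a \<Rightarrow>\<^sub>L real"

definition pos_dual :: "'a::real_normed_vector set \<Rightarrow> 'a dual set" where
  "pos_dual S = {x'. \<forall>u\<in>S. 0 \<le> blinfun_apply x' u}"

text \<open>
  The normal cones are intended for points of \<open>\<Omega>\<close>; elsewhere the same formulas apply but carry no meaning.
\<close>

definition frechet_normal_cone :: "'a::real_normed_vector \<Rightarrow> 'a set \<Rightarrow> 'a dual set" where
  "frechet_normal_cone y \<Omega> =
     {x'. \<forall>\<epsilon>>0. \<exists>\<delta>>0. \<forall>x\<in>\<Omega>. norm (x - y) \<le> \<delta> \<longrightarrow>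
            blinfun_apply x' (x - y) \<le> \<epsilon> * norm (x - y)}"

definition limiting_normal_cone :: "'a::real_normed_vector \<Rightarrow> 'a set \<Rightarrow> 'a dual set" where
  "limiting_normal_cone y \<Omega> =
     {x'. \<exists>(xs :: nat \<Rightarrow> 'a) (xs' :: nat \<Rightarrow> 'a dual).
            (\<forall>k. xs k \<in> \<Omega>) \<and> xs \<longlonglongrightarrow> y \<and>
            (\<forall>k. xs' k \<in> frechet_normal_cone (xs k) \<Omega>) \<and> xs' \<longlonglongrightarrow> x'}"

definition lipschitz_around :: "('a::real_normed_vector \<Rightarrow> ereal) \<Rightarrow> 'a \<Rightarrow> bool" where
  "lipschitz_around f a \<longleftrightarrow>
     (\<exists>L\<ge>0. \<exists>U. open U \<and> a \<in> U \<and> (\<forall>x\<in>U. \<bar>f x\<bar> \<noteq> \<infinity>) \<and>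
        (\<forall>x\<in>U. \<forall>y\<in>U. \<bar>real_of_ereal (f x) - real_of_ereal (f y)\<bar> \<le> L * norm (x - y)))"

definition recession_cone :: "'a::real_vector set \<Rightarrow> 'a set" where
  "recession_cone \<Omega> = {u. \<forall>w\<in>\<Omega>. \<forall>l::real. 0 \<le> l \<longrightarrow> w + l *\<^sub>R u \<in> \<Omega>}"

end

theory Submission
  imports Defs
begin

text \<open>
  By compactness of the dual unit sphere, the normal cone condition at \<open>y\<close> makes all Frechet normals
  \<open>x*\<close> at points of \<open>\<Omega>\<close> near \<open>y\<close> satisfy \<open>\<langle>x*, v\<rangle> \<le> - c \<parallel>x*\<parallel>\<close>. For an auxiliary inner product, \<open>z - p\<close> is a
  Frechet normal at any projection \<open>p\<close> of \<open>z\<close> on \<open>\<Omega>\<close>, so moving \<open>z\<close> in a direction \<open>w\<close> close to \<open>v\<close> does not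
  increase the squared distance to \<open>\<Omega>\<close> to first order. Hence \<open>x + t w \<in> \<Omega>\<close> for \<open>x \<in> \<Omega>\<close> near \<open>y\<close> and
  small \<open>t \<ge> 0\<close>. Taking \<open>w = v + (x' - x) / t\<close>, so that \<open>x + t w = x' + t v\<close>, turns
  this into a Lipschitz estimate for the minimal time.

  Conversely, a Lipschitz constant \<open>L\<close> supplies, for \<open>p \<in> \<Omega>\<close> and small \<open>h\<close>, a point
  \<open>p + h + \<tau> v \<in> \<Omega>\<close> with \<open>0 \<le> \<tau> \<le> L \<parallel>h\<parallel>\<close>. Testing a Frechet normal \<open>x*\<close> at \<open>p\<close> with it gives
  \<open>\<parallel>x*\<parallel> \<le> L max 0 (- \<langle>x*, v\<rangle>)\<close>, which survives the limit and forces \<open>x* = 0\<close> when \<open>\<langle>x*, v\<rangle> \<ge> 0\<close>.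
\<close>

section \<open>Coordinates, compactness and an inner product in finite dimension\<close>

text \<open>For a basis \<open>B\<close>, bounding the coordinate sum \<open>E\<close> by a multiple
  of \<open>norm\<close> makes the coordinates continuous. Otherwise vectors with
  \<open>E = 1\<close> tend to 0 in norm; a subsequence converges in every coordinate, hence in
  norm, to a limit that is 0 and yet has \<open>E = 1\<close>.\<close>

lemma finite_dimensional_coordinates:
  assumes "finite_dimensional TYPE('a::real_normed_vector)"
  obtains B :: "'a::real_normed_vector set" and c :: "'a \<Rightarrow> 'a dual"
  where "finite B" and "\<And>x. (\<Sum>b\<in>B. blinfun_apply (c b) x *\<^sub>R b) = x"
    and "\<And>a b. a \<in> B \<Longrightarrow> b \<in> B \<Longrightarrow> blinfun_apply (c a) b = (if a = b then 1 else 0)"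
proof -
  obtain S :: "'a set" where S: "finite S" "span S = UNIV"
    using assms unfolding finite_dimensional_def by blast
  obtain B where B: "B \<subseteq> S" "independent B" "S \<subseteq> span B"
    using maximal_independent_subset by blast
  have fin: "finite B" using B(1) S(1) finite_subset by blast
  have spB: "span B = UNIV"
    using S(2) B(3) by (metis span_mono span_span top.extremum_uniqueI)
  define R where "R = representation B"
  have lin: "linear (\<lambda>x. R x b)" for b
    unfolding R_def using linear_representation[OF B(2) spB] by (simp add: linear_def module_hom_iff_linear real_scaleR_def[abs_def])
  note R_simps = linear_add[OF lin] linear_scale[OF lin] linear_sum[OF lin]
  have sumR: "(\<Sum>b\<in>B. R x b *\<^sub>R b) = x" for x
    unfolding R_def using sum_representation_eq[OF B(2) _ fin order_refl] spB by blast
  have Rb: "R a b = (if b = a then 1 else 0)" if "a \<in> B" for a b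
    unfolding R_def using representation_basis[OF B(2) that] by simp
  have unproj: "R (\<Sum>b\<in>B. e b *\<^sub>R b) k = e k" if "k \<in> B" for e k
  proof -
    have "R (\<Sum>b\<in>B. e b *\<^sub>R b) k = (\<Sum>b\<in>B. e b * R b k)"
      by (simp add: R_simps)
    also have "\<dots> = (\<Sum>b\<in>B. if k = b then e b else 0)"
      by (rule sum.cong) (auto simp: Rb)
    finally show ?thesis using that fin by simp
  qed
  define E where "E x = (\<Sum>b\<in>B. \<bar>R x b\<bar>)" for x
  have Escale: "E (t *\<^sub>R x) = \<bar>t\<bar> * E x" for t x
    unfolding E_def by (simp add: R_simps abs_mult sum_distrib_left)
  have Rle: "\<bar>R x b\<bar> \<le> E x" if "b \<in> B" for x b
    unfolding E_def using fin that by (intro member_le_sum) auto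
  have "\<exists>K. \<forall>x. E x \<le> K * norm x"
  proof (rule ccontr)
    assume "\<not> ?thesis"
    then have "\<exists>x. E x > real (Suc n) * norm x" for n
      by (meson not_le_imp_less)
    then obtain x where x: "\<And>n. E (x n) > real (Suc n) * norm (x n)" by metis
    define u where "u n = (1 / E (x n)) *\<^sub>R x n" for n
    have Ex: "E (x n) > 0" for n
      using x[of n] by (smt (verit) mult_nonneg_nonneg norm_ge_zero of_nat_0_le_iff)
    have Eu: "E (u n) = 1" for n
      unfolding u_def Escale using Ex[of n] by simp
    have "norm (u n) \<le> 1 / real (Suc n)" for n
      unfolding u_def using Ex[of n] x[of n] by (simp add: field_simps)
    then have u0: "u \<longlonglongrightarrow> 0"
      by (intro Lim_null_comparison[OF _ LIMSEQ_Suc[OF lim_1_over_n]]) (auto intro!: always_eventually)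
    have "bounded ((\<lambda>y. R y b) ` range u)" if "b \<in> B" for b
      unfolding bounded_iff using Rle[OF that] Eu by (intro exI[of _ 1]) (metis imageE real_norm_def)
    then have "\<forall>d\<subseteq>B. \<exists>l::'a. \<exists> r::nat\<Rightarrow>nat.
      strict_mono r \<and> (\<forall>\<epsilon>>0. eventually (\<lambda>n. \<forall>i\<in>d. dist (R (u (r n)) i) (R l i) < \<epsilon>) sequentially)"
      by (intro compact_lemma_general[where unproj = "\<lambda>e. \<Sum>b\<in>B. e b *\<^sub>R b"] fin unproj sumR)
    then obtain l r where r: "strict_mono r"
      and l: "\<And>\<epsilon>. \<epsilon> > 0 \<Longrightarrow> eventually (\<lambda>n. \<forall>i\<in>B. dist (R (u (r n)) i) (R l i) < \<epsilon>) sequentially"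
      by blast
    have lim: "(\<lambda>n. R (u (r n)) b) \<longlonglongrightarrow> R l b" if "b \<in> B" for b
      unfolding tendsto_iff using l that by (auto intro: eventually_mono[OF l])
    have "(\<lambda>n. \<Sum>b\<in>B. R (u (r n)) b *\<^sub>R b) \<longlonglongrightarrow> (\<Sum>b\<in>B. R l b *\<^sub>R b)"
      by (intro tendsto_intros lim)
    then have "(u \<circ> r) \<longlonglongrightarrow> l" by (simp add: sumR o_def)
    with LIMSEQ_subseq_LIMSEQ[OF u0 r] have "l = 0" using LIMSEQ_unique by blast
    have "(\<lambda>n. E (u (r n))) \<longlonglongrightarrow> E l"
      unfolding E_def by (intro tendsto_intros lim)
    then have "E l = 1" using Eu LIMSEQ_unique[OF _ tendsto_const] by simp
    moreover have "E l = 0" using \<open>l = 0\<close> Escale[of 0 l] by simp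
    ultimately show False by simp
  qed
  then obtain K where K: "\<And>x. E x \<le> K * norm x" by blast
  have bl: "bounded_linear (\<lambda>x. R x b)" if "b \<in> B" for b
    using K Rle[OF that]
    by (intro bounded_linear_intro[where K = K])
       (auto simp: R_simps mult.commute intro: order_trans)
  have Blinfun_R: "blinfun_apply (Blinfun (\<lambda>x. R x b)) = (\<lambda>x. R x b)" if "b \<in> B" for b
    by (rule bounded_linear_Blinfun_apply[OF bl[OF that]])
  show thesis
    by (rule that[of B "\<lambda>b. Blinfun (\<lambda>x. R x b)"])
       (simp_all add: fin Blinfun_R sumR Rb cong: sum.cong)
qed

text \<open>Expanding \<open>x\<close> in coordinates writes \<open>f\<close> as the combination of
  the functionals \<open>c b\<close> with coefficients \<open>f b\<close>. This opens the dual unit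
  sphere to compactness arguments.\<close>

lemma finite_dimensional_dual:
  assumes "finite_dimensional TYPE('a::real_normed_vector)"
  shows "finite_dimensional TYPE('a::real_normed_vector dual)"
proof -
  obtain B :: "'a set" and c where B: "finite B"
    "\<And>x. (\<Sum>b\<in>B. blinfun_apply (c b) x *\<^sub>R b) = x"
    by (rule finite_dimensional_coordinates[OF assms]) (rule that)
  have "f \<in> span (c ` B)" for f :: "'a dual"
  proof -
    have "f = (\<Sum>b\<in>B. blinfun_apply f b *\<^sub>R c b)"
    proof (rule blinfun_eqI)
      fix x
      have "blinfun_apply f x = blinfun_apply f (\<Sum>b\<in>B. blinfun_apply (c b) x *\<^sub>R b)" by (simp add: B)
      also have "\<dots> = blinfun_apply (\<Sum>b\<in>B. blinfun_apply f b *\<^sub>R c b) x"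
        by (simp add: blinfun.bilinear_simps blinfun.sum_left blinfun.sum_right mult.commute)
      finally show "blinfun_apply f x = blinfun_apply (\<Sum>b\<in>B. blinfun_apply f b *\<^sub>R c b) x" .
    qed
    also have "\<dots> \<in> span (c ` B)" by (intro span_sum span_scale span_base imageI)
    finally show ?thesis .
  qed
  then show ?thesis unfolding finite_dimensional_def using B(1) by blast
qed

text \<open>Bolzano-Weierstrass: the coordinates of a bounded sequence are bounded, and finitely
  many convergent coordinates reassemble to a norm limit.\<close>

lemma finite_dimensional_bounded_subseq:
  fixes f :: "nat \<Rightarrow> 'a::real_normed_vector"
  assumes "finite_dimensional TYPE('a)" and "bounded (range f)"
  obtains l r where "strict_mono r" and "(f \<circ> r) \<longlonglongrightarrow> l"
proof -
  obtain B :: "'a set" and c where B: "finite B"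
    "\<And>x. (\<Sum>b\<in>B. blinfun_apply (c b) x *\<^sub>R b) = x"
    "\<And>a b. a \<in> B \<Longrightarrow> b \<in> B \<Longrightarrow> blinfun_apply (c a) b = (if a = b then 1 else 0)"
    by (rule finite_dimensional_coordinates[OF assms(1)]) (rule that)
  have "\<forall>d\<subseteq>B. \<exists>l::'a. \<exists> r::nat\<Rightarrow>nat.
      strict_mono r \<and> (\<forall>\<epsilon>>0. eventually (\<lambda>n. \<forall>i\<in>d. dist (blinfun_apply (c i) (f (r n))) (blinfun_apply (c i) l) < \<epsilon>) sequentially)"
  proof (rule compact_lemma_general[where unproj = "\<lambda>e. \<Sum>b\<in>B. e b *\<^sub>R b"])
    show "bounded ((\<lambda>x. blinfun_apply (c k) x) ` range f)" if "k \<in> B" for k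
      by (rule bounded_linear_image[OF assms(2) blinfun.bounded_linear_right])
    show "blinfun_apply (c k) (\<Sum>b\<in>B. e b *\<^sub>R b) = e k" if "k \<in> B" for e k
    proof -
      have "blinfun_apply (c k) (\<Sum>b\<in>B. e b *\<^sub>R b) = (\<Sum>b\<in>B. if k = b then e b else 0)"
        unfolding blinfun.sum_right by (rule sum.cong) (auto simp: blinfun.bilinear_simps B(3) that)
      then show ?thesis using that B(1) by simp
    qed
  qed (use B in auto)
  then obtain l r where r: "strict_mono r"
    and l: "\<And>\<epsilon>. \<epsilon> > 0 \<Longrightarrow> eventually (\<lambda>n. \<forall>i\<in>B. dist (blinfun_apply (c i) (f (r n))) (blinfun_apply (c i) l) < \<epsilon>) sequentially"
    by blast
  have lim: "(\<lambda>n. blinfun_apply (c b) (f (r n))) \<longlonglongrightarrow> blinfun_apply (c b) l" if "b \<in> B" for b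
    unfolding tendsto_iff using l that by (auto intro: eventually_mono[OF l])
  have "(\<lambda>n. \<Sum>b\<in>B. blinfun_apply (c b) (f (r n)) *\<^sub>R b) \<longlonglongrightarrow> (\<Sum>b\<in>B. blinfun_apply (c b) l *\<^sub>R b)"
    by (intro tendsto_intros lim)
  then have "(f \<circ> r) \<longlonglongrightarrow> l" by (simp add: B o_def)
  with r show thesis using that by blast
qed

lemma finite_dimensional_compact:
  fixes S :: "'a::real_normed_vector set"
  assumes "finite_dimensional TYPE('a)" and "bounded S" and "closed S"
  shows "compact S"
  unfolding compact_eq_seq_compact_metric seq_compact_def
proof (intro allI impI)
  fix f :: "nat \<Rightarrow> 'a" assume f: "\<forall>n. f n \<in> S"
  then have "bounded (range f)" by (intro bounded_subset[OF assms(2)]) auto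
  then obtain l r where "strict_mono r" "(f \<circ> r) \<longlonglongrightarrow> l"
    by (rule finite_dimensional_bounded_subseq[OF assms(1)]) (rule that)
  moreover have "l \<in> S"
    using closed_sequentially[OF assms(3) _ \<open>(f \<circ> r) \<longlonglongrightarrow> l\<close>] f by auto
  ultimately show "\<exists>l\<in>S. \<exists>r. strict_mono r \<and> (f \<circ> r) \<longlonglongrightarrow> l" by blast
qed

text \<open>The dot product of coordinates. Boundedness of the functionals \<open>c b\<close> bounds
  it above by the norm; Cauchy-Schwarz on the expansion of \<open>x\<close> in \<open>B\<close>
  bounds it below.\<close>

lemma finite_dimensional_inner:
  assumes "finite_dimensional TYPE('a::real_normed_vector)"
  obtains ip :: "'a::real_normed_vector \<Rightarrow> 'a \<Rightarrow> real" and C :: real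
  where "bounded_bilinear ip" and "\<And>x y. ip x y = ip y x" and "C > 0"
    and "\<And>x. (norm x)\<^sup>2 \<le> C * ip x x" and "\<And>x. ip x x \<le> C * (norm x)\<^sup>2"
proof -
  obtain B :: "'a set" and c where B: "finite B"
    "\<And>x. (\<Sum>b\<in>B. blinfun_apply (c b) x *\<^sub>R b) = x"
    by (rule finite_dimensional_coordinates[OF assms]) (rule that)
  define ip where "ip x y = (\<Sum>b\<in>B. blinfun_apply (c b) x * blinfun_apply (c b) y)" for x y
  define M where "M = (\<Sum>b\<in>B. (norm (c b))\<^sup>2)"
  define N where "N = (\<Sum>b\<in>B. (norm b)\<^sup>2)"
  have M0: "M \<ge> 0" and N0: "N \<ge> 0" unfolding M_def N_def by (auto intro: sum_nonneg)
  have pos: "ip x x \<ge> 0" for x unfolding ip_def by (auto intro: sum_nonneg)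
  have bnd: "\<bar>ip x y\<bar> \<le> norm x * norm y * M" for x y
  proof -
    have "\<bar>ip x y\<bar> \<le> (\<Sum>b\<in>B. \<bar>blinfun_apply (c b) x\<bar> * \<bar>blinfun_apply (c b) y\<bar>)"
      unfolding ip_def by (rule order_trans[OF sum_abs]) (simp add: abs_mult)
    also have "\<dots> \<le> (\<Sum>b\<in>B. (norm (c b) * norm x) * (norm (c b) * norm y))"
      using norm_blinfun[of "c _"] by (intro sum_mono mult_mono) auto
    also have "\<dots> = norm x * norm y * M"
      unfolding M_def by (simp add: sum_distrib_left power2_eq_square algebra_simps)
    finally show ?thesis .
  qed
  have up: "(norm x)\<^sup>2 \<le> N * ip x x" for x
  proof -
    have "norm x \<le> (\<Sum>b\<in>B. \<bar>blinfun_apply (c b) x\<bar> * norm b)"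
      using norm_sum[of "\<lambda>b. blinfun_apply (c b) x *\<^sub>R b" B] by (simp add: B)
    then have "(norm x)\<^sup>2 \<le> (\<Sum>b\<in>B. \<bar>blinfun_apply (c b) x\<bar> * norm b)\<^sup>2"
      by (simp add: power_mono)
    also have "\<dots> \<le> (\<Sum>b\<in>B. \<bar>blinfun_apply (c b) x\<bar>\<^sup>2) * (\<Sum>b\<in>B. (norm b)\<^sup>2)"
      by (rule Cauchy_Schwarz_ineq_sum)
    also have "\<dots> = N * ip x x" unfolding N_def ip_def by (simp add: power2_eq_square mult.commute)
    finally show ?thesis .
  qed
  show thesis
  proof
    show "bounded_bilinear ip"
    proof
      show "\<exists>K. \<forall>a b. norm (ip a b) \<le> norm a * norm b * K" using bnd by auto
    qed (simp_all add: ip_def blinfun.bilinear_simps distrib_left distrib_right sum.distrib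
           sum_distrib_left algebra_simps)
    show "ip x y = ip y x" for x y unfolding ip_def by (simp add: mult.commute)
    \<comment> \<open>The summand 1 keeps the constant positive even when \<open>B\<close> is
      empty.\<close>
    show "1 + M + N > 0" using M0 N0 by simp
    show "(norm x)\<^sup>2 \<le> (1 + M + N) * ip x x" for x
      using up[of x] mult_right_mono[of N "1 + M + N" "ip x x"] pos[of x] M0 by simp
    show "ip x x \<le> (1 + M + N) * (norm x)\<^sup>2" for x
      using bnd[of x x] mult_right_mono[of M "1 + M + N" "(norm x)\<^sup>2"] N0
      by (simp add: power2_eq_square mult.commute)
  qed
qed


section \<open>Normal cones and directions that stay in the set\<close>

lemma frechet_normal_cone_scaleR:
  assumes "f \<in> frechet_normal_cone y \<Omega>" and "t > 0"
  shows "t *\<^sub>R f \<in> frechet_normal_cone y \<Omega>"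
  unfolding frechet_normal_cone_def
proof (intro CollectI allI impI)
  fix e :: real assume "e > 0"
  then have "e / t > 0" using assms(2) by simp
  then obtain d where d: "d > 0"
    "\<forall>x\<in>\<Omega>. norm (x - y) \<le> d \<longrightarrow> blinfun_apply f (x - y) \<le> e / t * norm (x - y)"
    using assms(1) unfolding frechet_normal_cone_def by blast
  have "blinfun_apply (t *\<^sub>R f) (x - y) \<le> e * norm (x - y)" if "x \<in> \<Omega>" "norm (x - y) \<le> d" for x
    using mult_left_mono[of "blinfun_apply f (x - y)" "e / t * norm (x - y)" t] d(2) that assms(2)
    by (simp add: blinfun.scaleR_left)
  with d(1) show "\<exists>\<delta>>0. \<forall>x\<in>\<Omega>. norm (x - y) \<le> \<delta> \<longrightarrow>
      blinfun_apply (t *\<^sub>R f) (x - y) \<le> e * norm (x - y)" by blast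
qed

text \<open>Reduces the condition \<open>= {0}\<close> at a point of the set to an inclusion in
  \<open>{0}\<close>.\<close>

lemma zero_in_pos_dual_limiting_normal_cone:
  assumes "y \<in> \<Omega>"
  shows "0 \<in> pos_dual S \<inter> limiting_normal_cone y \<Omega>"
proof -
  have "0 \<in> frechet_normal_cone y \<Omega>"
    unfolding frechet_normal_cone_def by (auto intro: exI[of _ 1])
  then have "0 \<in> limiting_normal_cone y \<Omega>"
    unfolding limiting_normal_cone_def using assms
    by (intro CollectI exI[of _ "\<lambda>_. y"] exI[of _ "\<lambda>_. 0"]) auto
  then show ?thesis by (simp add: pos_dual_def)
qed

lemma frechet_normals_uniformly_negative:
  fixes \<Omega> :: "'a::real_normed_vector set"
  assumes fd: "finite_dimensional TYPE('a)"
    and nc: "pos_dual {v} \<inter> limiting_normal_cone y \<Omega> \<subseteq> {0}"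
  obtains c d where "c > 0" and "d > 0"
    and "\<And>x f. x \<in> \<Omega> \<Longrightarrow> norm (x - y) < d \<Longrightarrow> f \<in> frechet_normal_cone x \<Omega> \<Longrightarrow>
           blinfun_apply f v \<le> - c * norm f"
proof -
  \<comment> \<open>One number serves as margin and as radius, so negating with
    \<open>1 / Suc n\<close> yields violating normals at points tending to \<open>y\<close>.
    Normalized, they cluster at a unit limiting normal that is nonnegative on
    \<open>v\<close>.\<close>
  have "\<exists>c>0. \<forall>x f. x \<in> \<Omega> \<longrightarrow> norm (x - y) < c \<longrightarrow> f \<in> frechet_normal_cone x \<Omega> \<longrightarrow>
          blinfun_apply f v \<le> - c * norm f"
  proof (rule ccontr)
    assume neg: "\<not> ?thesis"
    have "\<exists>x f. x \<in> \<Omega> \<and> norm (x - y) < 1 / Suc n \<and> f \<in> frechet_normal_cone x \<Omega> \<and>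
          blinfun_apply f v > - (1 / Suc n) * norm f" for n
    proof -
      have "1 / real (Suc n) > 0" by simp
      then show ?thesis using neg by (meson not_le)
    qed
    then obtain x f where x: "\<And>n. x n \<in> \<Omega>" "\<And>n. norm (x n - y) < 1 / Suc n"
      and f: "\<And>n. f n \<in> frechet_normal_cone (x n) \<Omega>"
        "\<And>n. blinfun_apply (f n) v > - (1 / Suc n) * norm (f n)"
      by metis
    \<comment> \<open>The strict inequality \<open>f(2)\<close> excludes
      \<open>f n = 0\<close>.\<close>
    have f0: "norm (f n) > 0" for n using f(2)[of n] by auto
    define g where "g n = (1 / norm (f n)) *\<^sub>R f n" for n
    have g1: "norm (g n) = 1" for n unfolding g_def using f0[of n] by simp
    have gN: "g n \<in> frechet_normal_cone (x n) \<Omega>" for n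
      unfolding g_def using f0[of n] f(1)[of n] by (intro frechet_normal_cone_scaleR) auto
    have gv: "blinfun_apply (g n) v > - (1 / Suc n)" for n
      unfolding g_def using f0[of n] f(2)[of n] by (simp add: blinfun.bilinear_simps field_simps)
    have "bounded (range g)" using g1 by (auto simp: bounded_iff)
    then obtain l r where r: "strict_mono r" and l: "(g \<circ> r) \<longlonglongrightarrow> l"
      by (rule finite_dimensional_bounded_subseq[OF finite_dimensional_dual[OF fd]]) (rule that)
    have inv0: "(\<lambda>n. 1 / real (Suc n)) \<longlonglongrightarrow> 0" by (rule LIMSEQ_Suc[OF lim_1_over_n])
    have "x \<longlonglongrightarrow> y"
      unfolding LIM_zero_iff[symmetric, of x]
      using x(2) by (intro Lim_null_comparison[OF _ inv0] always_eventually) (auto intro: less_imp_le)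
    then have "(x \<circ> r) \<longlonglongrightarrow> y" using LIMSEQ_subseq_LIMSEQ r by blast
    then have "l \<in> limiting_normal_cone y \<Omega>"
      unfolding limiting_normal_cone_def using x(1) gN l
      by (auto intro!: exI[of _ "x \<circ> r"] exI[of _ "g \<circ> r"])
    moreover have "blinfun_apply l v \<ge> 0"
    proof (rule LIMSEQ_le)
      show "(\<lambda>n. blinfun_apply ((g \<circ> r) n) v) \<longlonglongrightarrow> blinfun_apply l v"
        by (intro tendsto_intros l)
      show "(\<lambda>n. - ((\<lambda>n. 1 / real (Suc n)) \<circ> r) n) \<longlonglongrightarrow> 0"
        using tendsto_minus[OF LIMSEQ_subseq_LIMSEQ[OF inv0 r]] by simp
      show "\<exists>N. \<forall>n\<ge>N. - ((\<lambda>n. 1 / real (Suc n)) \<circ> r) n \<le> blinfun_apply ((g \<circ> r) n) v"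
        using gv by (auto intro!: less_imp_le)
    qed
    ultimately have "l = 0" using nc by (auto simp: pos_dual_def)
    moreover have "norm l = 1"
      using tendsto_norm[OF l] LIMSEQ_unique[OF _ tendsto_const] by (simp add: o_def g1)
    ultimately show False by simp
  qed
  then show thesis using that by blast
qed

lemma closed_stable_directions:
  fixes \<Omega> :: "'a::real_normed_vector set"
  assumes fd: "finite_dimensional TYPE('a)" and cl: "closed \<Omega>" and y: "y \<in> \<Omega>"
    and nc: "pos_dual {v} \<inter> limiting_normal_cone y \<Omega> \<subseteq> {0}"
  obtains r where "r > 0"
    and "\<And>x w t. x \<in> \<Omega> \<Longrightarrow> norm (x - y) \<le> r \<Longrightarrow> norm (w - v) \<le> r \<Longrightarrow> 0 \<le> t \<Longrightarrow> t \<le> r \<Longrightarrow>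
           x + t *\<^sub>R w \<in> \<Omega>"
proof -
  obtain ip :: "'a \<Rightarrow> 'a \<Rightarrow> real" and C where bil: "bounded_bilinear ip"
    and sym: "\<And>x y. ip x y = ip y x" and C: "C > 0"
    and n_ip: "\<And>x. (norm x)\<^sup>2 \<le> C * ip x x" and ip_n: "\<And>x. ip x x \<le> C * (norm x)\<^sup>2"
    by (rule finite_dimensional_inner[OF fd]) (rule that)
  interpret ip: bounded_bilinear ip by (rule bil)
  have ip_diff: "ip (a - b) (a - b) = ip a a - 2 * ip a b + ip b b" for a b
    using sym[of a b] by (simp add: ip.diff_left ip.diff_right)
  have ip_add: "ip (a + b) (a + b) = ip a a + 2 * ip a b + ip b b" for a b
    using sym[of a b] by (simp add: ip.add_left ip.add_right)
  have ip_pos: "ip a a \<ge> 0" for a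
    using n_ip[of a] C by (smt (verit) zero_le_power2 mult_pos_neg)
  obtain c d where c: "c > 0" and d: "d > 0"
    and neg: "\<And>x f. x \<in> \<Omega> \<Longrightarrow> norm (x - y) < d \<Longrightarrow> f \<in> frechet_normal_cone x \<Omega> \<Longrightarrow>
           blinfun_apply f v \<le> - c * norm f"
    by (rule frechet_normals_uniformly_negative[OF fd nc]) (rule that)
  have proj: "\<exists>p\<in>\<Omega>. \<forall>q\<in>\<Omega>. ip (z - p) (z - p) \<le> ip (z - q) (z - q)" for z
  proof -
    \<comment> \<open>The factor \<open>C\<close> makes points outside the ball at least as far from
      \<open>z\<close> as \<open>y\<close> in the \<open>ip\<close> distance, by the two comparisons
      with \<open>norm\<close>; the \<open>+ 1\<close> puts \<open>y\<close> in the ball.\<close>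
    define R where "R = (C + 1) * norm (z - y)"
    have R: "norm (z - y) \<le> R" unfolding R_def using C by (simp add: distrib_right)
    have "compact (\<Omega> \<inter> cball z R)"
      using cl by (intro finite_dimensional_compact[OF fd]) (auto intro: closed_Int)
    moreover have "y \<in> \<Omega> \<inter> cball z R" using y R by (simp add: dist_norm)
    moreover have "continuous_on (\<Omega> \<inter> cball z R) (\<lambda>q. ip (z - q) (z - q))"
      by (intro ip.continuous_on continuous_intros)
    ultimately obtain p where p: "p \<in> \<Omega>" and
      min: "\<And>q. q \<in> \<Omega> \<inter> cball z R \<Longrightarrow> ip (z - p) (z - p) \<le> ip (z - q) (z - q)"
      using continuous_attains_inf[of "\<Omega> \<inter> cball z R"] by blast
    have "ip (z - p) (z - p) \<le> ip (z - q) (z - q)" if q: "q \<in> \<Omega>" for q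
    proof (cases "q \<in> cball z R")
      case False
      then have "R \<le> norm (z - q)" by (simp add: dist_norm)
      then have "C * norm (z - y) \<le> norm (z - q)"
        unfolding R_def distrib_right using norm_ge_zero[of "z - y"] by linarith
      then have "(C * norm (z - y))\<^sup>2 \<le> (norm (z - q))\<^sup>2"
        using C by (intro power_mono) auto
      also have "\<dots> \<le> C * ip (z - q) (z - q)" by (rule n_ip)
      finally have "C * (norm (z - y))\<^sup>2 \<le> ip (z - q) (z - q)"
        using C by (simp add: power2_eq_square mult.left_commute)
      then show ?thesis using min[OF \<open>y \<in> \<Omega> \<inter> cball z R\<close>] ip_n[of "z - y"] by linarith
    qed (use min q in blast)
    with p show ?thesis by blast
  qed
  \<comment> \<open>Keeps the projections of points near \<open>y\<close> within the radius
    \<open>d\<close> where \<open>neg\<close> applies.\<close>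
  have proj_near: "norm (p - y) \<le> (C + 1) * norm (z - y)"
    if min: "\<forall>q\<in>\<Omega>. ip (z - p) (z - p) \<le> ip (z - q) (z - q)" for p z
  proof -
    have "(norm (z - p))\<^sup>2 \<le> C * ip (z - p) (z - p)" by (rule n_ip)
    also have "\<dots> \<le> C * (C * (norm (z - y))\<^sup>2)"
      using min y ip_n[of "z - y"] C by (intro mult_left_mono) (auto intro: order_trans)
    also have "\<dots> = (C * norm (z - y))\<^sup>2" by (simp add: power2_eq_square)
    finally have "norm (z - p) \<le> C * norm (z - y)"
      using C by (simp add: power2_le_iff_abs_le)
    moreover have "norm (p - y) \<le> norm (z - p) + norm (z - y)"
      using dist_triangle[of p y z] by (simp add: dist_norm norm_minus_commute)
    ultimately show ?thesis by (simp add: distrib_right)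
  qed
  \<comment> \<open>Comparing \<open>p\<close> with \<open>x\<close> bounds
    \<open>2 * ip (z - p) (x - p)\<close> by the second-order term
    \<open>ip (x - p) (x - p)\<close>; within radius \<open>2 * e / C\<close> this is at most linear
    with slope \<open>2 * e\<close>.\<close>
  have proj_normal: "Blinfun (ip (z - p)) \<in> frechet_normal_cone p \<Omega>"
    if p: "p \<in> \<Omega>" and min: "\<forall>q\<in>\<Omega>. ip (z - p) (z - p) \<le> ip (z - q) (z - q)" for p z
    unfolding frechet_normal_cone_def
  proof (intro CollectI allI impI)
    fix e :: real assume e: "e > 0"
    have "blinfun_apply (Blinfun (ip (z - p))) (x - p) \<le> e * norm (x - p)"
      if x: "x \<in> \<Omega>" "norm (x - p) \<le> 2 * e / C" for x
    proof -
      have "ip (z - p) (z - p) \<le> ip ((z - p) - (x - p)) ((z - p) - (x - p))"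
        using min x(1) by simp
      then have "2 * ip (z - p) (x - p) \<le> C * (norm (x - p))\<^sup>2"
        unfolding ip_diff[of "z - p" "x - p"] using ip_n[of "x - p"] by linarith
      also have "\<dots> = (C * norm (x - p)) * norm (x - p)" by (simp add: power2_eq_square)
      also have "\<dots> \<le> (2 * e) * norm (x - p)"
        using x(2) C by (intro mult_right_mono) (auto simp: field_simps)
      finally show ?thesis by (simp add: bounded_linear_Blinfun_apply ip.bounded_linear_right)
    qed
    then show "\<exists>\<delta>>0. \<forall>x\<in>\<Omega>. norm (x - p) \<le> \<delta> \<longrightarrow>
        blinfun_apply (Blinfun (ip (z - p))) (x - p) \<le> e * norm (x - p)"
      using e C by (intro exI[of _ "2 * e / C"]) auto
  qed
  \<comment> \<open>A point \<open>z\<close> reached from \<open>x\<close> within time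
    \<open>r\<close> has \<open>norm (z - y) \<le> r * (1 + norm v + c)\<close>, so its projection
    is within \<open>r * D\<close> of \<open>y\<close>. The bound \<open>d / (2 * D)\<close> on
    \<open>r\<close> keeps this below \<open>d\<close>; the bound \<open>c\<close> limits the tilt
    of \<open>w\<close>.\<close>
  define D where "D = (C + 1) * (1 + norm v + c)"
  have D: "D > 0" unfolding D_def using C c by (intro mult_pos_pos) (auto intro: add_nonneg_pos add_pos_nonneg)
  define r where "r = min c (d / (2 * D))"
  have r: "r > 0" unfolding r_def using c d D by simp
  have rd: "r * D < d"
  proof -
    have "r * D \<le> d / (2 * D) * D" unfolding r_def using D by (intro mult_right_mono) auto
    also have "\<dots> < d" using D d by simp
    finally show ?thesis .
  qed
  have "x + t *\<^sub>R w \<in> \<Omega>"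
    if x: "x \<in> \<Omega>" "norm (x - y) \<le> r" and w: "norm (w - v) \<le> r" and t: "0 \<le> t" "t \<le> r" for x w t
  proof -
    have wc: "norm (w - v) \<le> c" using w unfolding r_def by simp
    have nw: "norm w \<le> norm v + c" using wc norm_triangle_sub[of w v] by linarith
    have dir: "ip (z - p) w \<le> 0"
      if p: "p \<in> \<Omega>" and min: "\<forall>q\<in>\<Omega>. ip (z - p) (z - p) \<le> ip (z - q) (z - q)"
        and z: "z = x + s *\<^sub>R w" "0 \<le> s" "s \<le> t" for p z s
    proof -
      have "norm (z - y) = norm ((x - y) + s *\<^sub>R w)" unfolding z by (simp add: algebra_simps)
      also have "\<dots> \<le> norm (x - y) + s * norm w"
        using norm_triangle_ineq[of "x - y" "s *\<^sub>R w"] z(2) by simp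
      also have "\<dots> \<le> r + r * (norm v + c)"
        using x(2) z(2,3) t nw by (intro add_mono mult_mono) auto
      finally have "norm (z - y) \<le> r * (1 + norm v + c)" by (simp add: algebra_simps)
      then have "(C + 1) * norm (z - y) \<le> r * D"
        unfolding D_def using mult_left_mono[of "norm (z - y)" "r * (1 + norm v + c)" "C + 1"] C
        by (simp add: mult.commute mult.left_commute)
      then have "norm (p - y) < d" using proj_near[OF min] rd by linarith
      define f where "f = Blinfun (ip (z - p))"
      have fa: "blinfun_apply f = ip (z - p)"
        unfolding f_def by (simp add: bounded_linear_Blinfun_apply ip.bounded_linear_right)
      \<comment> \<open>The margin \<open>- c * norm f\<close> absorbs the contribution of
        \<open>w - v\<close>, whose norm is at most \<open>c\<close>.\<close>
      have "blinfun_apply f v \<le> - c * norm f"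
        using neg[OF p \<open>norm (p - y) < d\<close>] proj_normal[OF p min] unfolding f_def by blast
      moreover have "blinfun_apply f (w - v) \<le> norm f * c"
        using norm_blinfun[of f "w - v"] mult_left_mono[OF wc, of "norm f"] by auto
      moreover have "blinfun_apply f w = blinfun_apply f v + blinfun_apply f (w - v)"
        by (simp add: blinfun.bilinear_simps)
      ultimately show ?thesis using fa by (simp add: mult.commute)
    qed
    text \<open>Each step of length \<open>h\<close> raises the squared distance by at most \<open>h\<^sup>2 ip w w\<close>, so \<open>n\<close> steps of length
      \<open>t / n\<close> raise it by \<open>O(1 / n)\<close>.
    \<close>
    have step: "\<exists>q\<in>\<Omega>. ip (x + (real i * h) *\<^sub>R w - q) (x + (real i * h) *\<^sub>R w - q) \<le> real i * (h\<^sup>2 * ip w w)"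
      if h: "0 \<le> h" "real i * h \<le> t" for i h
      using h(2)
    proof (induction i)
      case 0
      then show ?case using x(1) by (auto intro!: bexI[of _ x] simp: ip.zero_left)
    next
      case (Suc i)
      define z where "z = x + (real i * h) *\<^sub>R w"
      have ih: "real i * h \<le> t" using Suc.prems h(1) by (simp add: algebra_simps)
      obtain p where p: "p \<in> \<Omega>" "\<forall>q\<in>\<Omega>. ip (z - p) (z - p) \<le> ip (z - q) (z - q)"
        using proj by blast
      have le: "ip (z - p) (z - p) \<le> real i * (h\<^sup>2 * ip w w)"
        using Suc.IH[OF ih] p(2) unfolding z_def[symmetric] by (meson order_trans)
      \<comment> \<open>The cross term is nonpositive, so a step adds only the quadratic term.
        Keeping the old projection \<open>p\<close> as competitor for the next point replaces
        differentiating the distance.\<close>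
      have "ip (z - p) w \<le> 0" by (rule dir[OF p z_def]) (use h ih in auto)
      then have "h * ip (z - p) w \<le> 0" using h(1) by (simp add: mult_nonneg_nonpos)
      then have "ip ((z - p) + h *\<^sub>R w) ((z - p) + h *\<^sub>R w) \<le> ip (z - p) (z - p) + h\<^sup>2 * ip w w"
        unfolding ip_add by (simp add: ip.scaleR_left ip.scaleR_right power2_eq_square)
      moreover have "x + (real (Suc i) * h) *\<^sub>R w - p = (z - p) + h *\<^sub>R w"
        unfolding z_def by (simp add: algebra_simps)
      ultimately have "ip (x + (real (Suc i) * h) *\<^sub>R w - p) (x + (real (Suc i) * h) *\<^sub>R w - p)
          \<le> ip (z - p) (z - p) + h\<^sup>2 * ip w w"
        by (simp only:)
      then show ?case using le p(1) by (intro bexI[of _ p]) (auto simp: algebra_simps)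
    qed
    \<comment> \<open>With \<open>Suc n\<close> steps the division is safe for every
      \<open>n\<close>. The points found converge to the endpoint, and closedness concludes.\<close>
    have "\<exists>q\<in>\<Omega>. (norm (x + t *\<^sub>R w - q))\<^sup>2 \<le> C * (t\<^sup>2 * ip w w) * (1 / real (Suc n))" for n
    proof -
      obtain q where q: "q \<in> \<Omega>"
        "ip (x + t *\<^sub>R w - q) (x + t *\<^sub>R w - q) \<le> real (Suc n) * ((t / real (Suc n))\<^sup>2 * ip w w)"
        using step[of "t / real (Suc n)" "Suc n"] t by (auto simp del: of_nat_Suc)
      have "(norm (x + t *\<^sub>R w - q))\<^sup>2 \<le> C * (real (Suc n) * ((t / real (Suc n))\<^sup>2 * ip w w))"
        using n_ip[of "x + t *\<^sub>R w - q"] mult_left_mono[OF q(2), of C] C by linarith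
      also have "\<dots> = C * (t\<^sup>2 * ip w w) * (1 / real (Suc n))"
        by (simp add: power2_eq_square field_simps del: of_nat_Suc)
      finally show ?thesis using q(1) by blast
    qed
    then obtain q where q: "\<And>n. q n \<in> \<Omega>"
      "\<And>n. (norm (x + t *\<^sub>R w - q n))\<^sup>2 \<le> C * (t\<^sup>2 * ip w w) * (1 / real (Suc n))"
      by metis
    have "(\<lambda>n. (norm (x + t *\<^sub>R w - q n))\<^sup>2) \<longlonglongrightarrow> 0"
      using q(2) by (intro Lim_null_comparison[OF _ tendsto_mult_right_zero[OF LIMSEQ_Suc[OF lim_1_over_n]]]
          always_eventually) auto
    then have "(\<lambda>n. norm (x + t *\<^sub>R w - q n)) \<longlonglongrightarrow> 0"
      using tendsto_real_sqrt by fastforce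
    then have "(\<lambda>n. x + t *\<^sub>R w - q n) \<longlonglongrightarrow> 0" by (simp add: tendsto_norm_zero_iff)
    then have "q \<longlonglongrightarrow> x + t *\<^sub>R w"
      using tendsto_diff[OF tendsto_const[of "x + t *\<^sub>R w"]] by fastforce
    then show ?thesis using closed_sequentially[OF cl] q(1) by blast
  qed
  with r show thesis using that by blast
qed

section \<open>Attainment and lower semicontinuity of the minimal time\<close>

lemma min_time_le:
  assumes "0 \<le> t" and "x + t *\<^sub>R v \<in> \<Omega>"
  shows "min_time \<Omega> v x \<le> ereal t"
  unfolding min_time_def using assms by (auto intro: Inf_lower)

text \<open>The admissible times form a closed subset of the half-line, the preimage of a closed set
  under the ray. It is nonempty because the infimum of no times would be
  \<open>\<infinity>\<close>.\<close>

lemma min_time_attained: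
  fixes \<Omega> :: "'a::real_normed_vector set"
  assumes "closed \<Omega>" and "x \<in> eff_dom (min_time \<Omega> v)"
  obtains t where "0 \<le> t" and "min_time \<Omega> v x = ereal t" and "x + t *\<^sub>R v \<in> \<Omega>"
proof -
  define S where "S = {0..} \<inter> (\<lambda>t. x + t *\<^sub>R v) -` \<Omega>"
  have ne: "S \<noteq> {}"
  proof
    assume "S = {}"
    then have "{ereal t | t. 0 \<le> t \<and> x + t *\<^sub>R v \<in> \<Omega>} = {}" unfolding S_def by auto
    then have "min_time \<Omega> v x = \<infinity>" unfolding min_time_def by (simp only: Inf_empty top_ereal_def)
    then show False using assms(2) by (simp add: eff_dom_def)
  qed
  have bdd: "bdd_below S" unfolding S_def by (auto intro: bdd_belowI[of _ 0])
  have "closed S"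
    unfolding S_def by (intro closed_Int closed_atLeast closed_vimage[OF assms(1)] continuous_intros)
  with ne bdd have mem: "Inf S \<in> S" by (rule closed_contains_Inf)
  have "min_time \<Omega> v x = ereal (Inf S)"
  proof (rule antisym)
    show "min_time \<Omega> v x \<le> ereal (Inf S)" using mem unfolding S_def by (intro min_time_le) auto
    show "ereal (Inf S) \<le> min_time \<Omega> v x"
      unfolding min_time_def using bdd by (intro Inf_greatest) (auto simp: S_def intro!: cInf_lower)
  qed
  with mem show thesis using that unfolding S_def by auto
qed

text \<open>The compact segment swept from \<open>a\<close> up to time \<open>t0 - e\<close> misses
  the closed set, hence keeps a positive distance \<open>d\<close> from it; moving the start by less
  than \<open>d\<close> keeps the segment off the set. Bounding all admissible times gives lower
  semicontinuity in real terms.\<close>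

lemma min_time_lsc:
  assumes "closed \<Omega>" and "min_time \<Omega> v a = ereal t0" and "e > 0"
  obtains d where "d > 0"
    and "\<And>x t. norm (x - a) < d \<Longrightarrow> 0 \<le> t \<Longrightarrow> x + t *\<^sub>R v \<in> \<Omega> \<Longrightarrow> t0 - e < t"
proof -
  have "\<exists>d>0. \<forall>q\<in>\<Omega>. \<forall>t\<in>{0..t0 - e}. d \<le> dist (a + t *\<^sub>R v) q"
  \<comment> \<open>Degenerate cases: \<open>infdist\<close> to the empty set is 0 by convention,
    and for \<open>e > t0\<close> there is no time at which to minimize.\<close>
  proof (cases "\<Omega> = {} \<or> {0..t0 - e} = {}")
    case True
    then show ?thesis by (auto intro: exI[of _ 1])
  next
    case False
    have "continuous_on {0..t0 - e} (\<lambda>t. infdist (a + t *\<^sub>R v) \<Omega>)"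
      by (intro continuous_on_infdist continuous_on_add continuous_on_const continuous_on_scaleR
          continuous_on_id)
    then obtain s where s: "s \<in> {0..t0 - e}"
      and min: "\<forall>t\<in>{0..t0 - e}. infdist (a + s *\<^sub>R v) \<Omega> \<le> infdist (a + t *\<^sub>R v) \<Omega>"
      using continuous_attains_inf[OF compact_Icc] False by blast
    have "a + s *\<^sub>R v \<notin> \<Omega>"
      using min_time_le[of s a v \<Omega>] s assms(2,3) by auto
    then have "infdist (a + s *\<^sub>R v) \<Omega> > 0"
      using infdist_pos_not_in_closed[OF assms(1)] False by simp
    moreover have "infdist (a + s *\<^sub>R v) \<Omega> \<le> dist (a + t *\<^sub>R v) q"
      if "q \<in> \<Omega>" "t \<in> {0..t0 - e}" for q t
      using min[rule_format, OF that(2)] infdist_le[OF that(1)] by (rule order_trans)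
    ultimately show ?thesis by blast
  qed
  then obtain d where d: "d > 0"
    "\<And>q t. q \<in> \<Omega> \<Longrightarrow> t \<in> {0..t0 - e} \<Longrightarrow> d \<le> dist (a + t *\<^sub>R v) q"
    by blast
  have "t0 - e < t" if "norm (x - a) < d" "0 \<le> t" "x + t *\<^sub>R v \<in> \<Omega>" for x t
  proof (rule ccontr)
    assume "\<not> t0 - e < t"
    then have "d \<le> dist (a + t *\<^sub>R v) (x + t *\<^sub>R v)" using that(2) by (intro d(2)[OF that(3)]) simp
    then show False using that(1) by (simp add: dist_norm norm_minus_commute)
  qed
  with d(1) show thesis using that by blast
qed

section \<open>From the normal cone condition to Lipschitz continuity\<close>

lemma lipschitz_around_min_time:
  fixes \<Omega> :: "'a::real_normed_vector set"
  assumes fd: "finite_dimensional TYPE('a)" and cl: "closed \<Omega>"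
    and t0: "0 \<le> t0" "min_time \<Omega> v a = ereal t0" "a + t0 *\<^sub>R v \<in> \<Omega>"
    and nc: "pos_dual {v} \<inter> limiting_normal_cone (a + t0 *\<^sub>R v) \<Omega> \<subseteq> {0}"
  shows "lipschitz_around (min_time \<Omega> v) a"
proof -
  obtain r where r: "r > 0" and stable: "\<And>x w t. x \<in> \<Omega> \<Longrightarrow> norm (x - (a + t0 *\<^sub>R v)) \<le> r \<Longrightarrow>
      norm (w - v) \<le> r \<Longrightarrow> 0 \<le> t \<Longrightarrow> t \<le> r \<Longrightarrow> x + t *\<^sub>R w \<in> \<Omega>"
    by (rule closed_stable_directions[OF fd cl t0(3) nc]) (rule that)
  \<comment> \<open>Arrival from \<open>x\<close> at time \<open>s\<close> gives arrival from
    \<open>y\<close> with delay \<open>norm (y - x) / r\<close>, whence the constant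
    \<open>1 / r\<close>. The delay \<open>T\<close> puts the tilted direction at distance exactly
    \<open>r\<close> from \<open>v\<close>, and \<open>norm (y - x) \<le> r * r\<close> means
    \<open>T \<le> r\<close>.\<close>
  have key: "y + (s + norm (y - x) / r) *\<^sub>R v \<in> \<Omega>"
    if "x + s *\<^sub>R v \<in> \<Omega>" "norm (x + s *\<^sub>R v - (a + t0 *\<^sub>R v)) \<le> r" "norm (y - x) \<le> r * r" for x y s
  proof (cases "y = x")
    case False
    define T where "T = norm (y - x) / r"
    have T: "T > 0" "T \<le> r" unfolding T_def using False r that(3) by (auto simp: field_simps)
    have "norm ((v + (1 / T) *\<^sub>R (y - x)) - v) = r"
      unfolding T_def using False r by simp
    then have "norm ((v + (1 / T) *\<^sub>R (y - x)) - v) \<le> r" by (rule eq_refl)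
    then have "(x + s *\<^sub>R v) + T *\<^sub>R (v + (1 / T) *\<^sub>R (y - x)) \<in> \<Omega>"
      using T by (intro stable[OF that(1,2)]) simp_all
    moreover have "(x + s *\<^sub>R v) + T *\<^sub>R (v + (1 / T) *\<^sub>R (y - x)) = y + (s + T) *\<^sub>R v"
      using T(1) by (simp add: algebra_simps)
    ultimately show ?thesis unfolding T_def by simp
  qed (use that in simp)
  \<comment> \<open>A time error up to \<open>e\<close> displaces the landing point by at most
    \<open>r / 2\<close>; the \<open>+ 1\<close> covers \<open>v = 0\<close>.\<close>
  define e where "e = r / (2 * (norm v + 1))"
  have e: "e > 0" "e * norm v \<le> r / 2"
    unfolding e_def using r by (auto simp: field_simps add_pos_nonneg add_nonneg_pos)
  obtain d where d: "d > 0"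
    and lsc: "\<And>x t. norm (x - a) < d \<Longrightarrow> 0 \<le> t \<Longrightarrow> x + t *\<^sub>R v \<in> \<Omega> \<Longrightarrow> t0 - e < t"
    by (rule min_time_lsc[OF cl t0(2) e(1)]) (rule that)
  \<comment> \<open>In order: \<open>d\<close> for \<open>lsc\<close>; \<open>r * r / 2\<close> so
    that two points of the ball satisfy the hypothesis of \<open>key\<close>; \<open>r * e\<close>
    so that the delay from \<open>a\<close> is below \<open>e\<close>; \<open>r / 2\<close> for the
    other half of the landing error.\<close>
  define \<rho> where "\<rho> = Min {d, r * r / 2, r * e, r / 2}"
  have \<rho>: "\<rho> > 0" "\<rho> \<le> d" "\<rho> \<le> r * r / 2" "\<rho> \<le> r * e" "\<rho> \<le> r / 2"
    unfolding \<rho>_def using d r e by auto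
  \<comment> \<open>\<open>key\<close> from \<open>a\<close> bounds the optimal time above and
    \<open>lsc\<close> bounds it below, so landing points stay in the region where
    \<open>key\<close> applies again.\<close>
  have val: "\<exists>t. 0 \<le> t \<and> min_time \<Omega> v x = ereal t \<and> x + t *\<^sub>R v \<in> \<Omega> \<and>
      norm (x + t *\<^sub>R v - (a + t0 *\<^sub>R v)) \<le> r" if x: "norm (x - a) < \<rho>" for x
  proof -
    have mem: "x + (t0 + norm (x - a) / r) *\<^sub>R v \<in> \<Omega>"
    proof (rule key[OF t0(3)])
      show "norm (x - a) \<le> r * r" using x \<rho>(3) zero_less_mult_iff[of r r] r by linarith
    qed (use r in simp)
    have nn: "0 \<le> t0 + norm (x - a) / r" using t0(1) r by simp
    have le: "min_time \<Omega> v x \<le> ereal (t0 + norm (x - a) / r)"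
      by (rule min_time_le[OF nn mem])
    then have "x \<in> eff_dom (min_time \<Omega> v)" unfolding eff_dom_def by (auto intro: le_less_trans)
    then obtain t where t: "0 \<le> t" "min_time \<Omega> v x = ereal t" "x + t *\<^sub>R v \<in> \<Omega>"
      by (rule min_time_attained[OF cl]) (rule that)
    have "norm (x - a) / r < e" using x \<rho>(4) r by (simp add: field_simps)
    then have "t - t0 \<le> e" using le t(2) by simp
    moreover have "t0 - e < t" using lsc[OF _ t(1,3)] x \<rho>(2) by simp
    ultimately have "\<bar>t - t0\<bar> \<le> e" by linarith
    have "norm (x + t *\<^sub>R v - (a + t0 *\<^sub>R v)) = norm ((x - a) + (t - t0) *\<^sub>R v)"
      by (simp add: algebra_simps)
    also have "\<dots> \<le> norm (x - a) + \<bar>t - t0\<bar> * norm v"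
      using norm_triangle_ineq[of "x - a" "(t - t0) *\<^sub>R v"] by simp
    also have "\<dots> \<le> r / 2 + r / 2"
      using x \<rho>(5) e(2) mult_right_mono[OF \<open>\<bar>t - t0\<bar> \<le> e\<close>, of "norm v"] by simp
    finally show ?thesis using t by auto
  qed
  have half: "real_of_ereal (min_time \<Omega> v y) - real_of_ereal (min_time \<Omega> v x) \<le> (1 / r) * norm (y - x)"
    if x: "norm (x - a) < \<rho>" and y: "norm (y - a) < \<rho>" for x y
  proof -
    obtain s where s: "0 \<le> s" "min_time \<Omega> v x = ereal s" "x + s *\<^sub>R v \<in> \<Omega>"
      "norm (x + s *\<^sub>R v - (a + t0 *\<^sub>R v)) \<le> r"
      using val[OF x] by blast
    obtain t where t: "min_time \<Omega> v y = ereal t" using val[OF y] by blast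
    have "norm (y - x) \<le> norm (y - a) + norm (x - a)"
      by (metis dist_norm dist_triangle2)
    then have "norm (y - x) \<le> r * r" using x y \<rho>(3) by linarith
    then have "min_time \<Omega> v y \<le> ereal (s + norm (y - x) / r)"
      using s r by (intro min_time_le key) auto
    then show ?thesis using s(2) t by simp
  qed
  show ?thesis
    unfolding lipschitz_around_def
  proof (intro exI conjI ballI)
    show "0 \<le> 1 / r" using r by simp
    show "open (ball a \<rho>)" "a \<in> ball a \<rho>" using \<rho>(1) by auto
    fix x assume "x \<in> ball a \<rho>"
    then have x: "norm (x - a) < \<rho>" by (simp add: dist_norm norm_minus_commute)
    then show "\<bar>min_time \<Omega> v x\<bar> \<noteq> \<infinity>" using val by fastforce
    fix y assume "y \<in> ball a \<rho>"
    then have y: "norm (y - a) < \<rho>" by (simp add: dist_norm norm_minus_commute)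
    show "\<bar>real_of_ereal (min_time \<Omega> v x) - real_of_ereal (min_time \<Omega> v y)\<bar> \<le> 1 / r * norm (x - y)"
      using half[OF x y] half[OF y x] by (simp add: abs_le_iff norm_minus_commute)
  qed
qed

section \<open>From Lipschitz continuity to the normal cone condition\<close>

text \<open>Nearby normals may be negative on \<open>v\<close> and need not vanish; an inequality
  continuous in \<open>f\<close> survives the passage to limiting normals.\<close>

lemma frechet_normal_norm_le:
  fixes f :: "'a::real_normed_vector dual"
  assumes f: "f \<in> frechet_normal_cone p \<Omega>" and L: "L \<ge> 0" and "\<rho> > 0"
    and move: "\<And>h. norm h < \<rho> \<Longrightarrow> \<exists>\<tau>. 0 \<le> \<tau> \<and> \<tau> \<le> L * norm h \<and> p + h + \<tau> *\<^sub>R v \<in> \<Omega>"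
  shows "norm f \<le> L * max 0 (- blinfun_apply f v)"
proof (rule field_le_epsilon)
  fix e :: real assume e: "e > 0"
  define \<eta> where "\<eta> = max 0 (- blinfun_apply f v)"
  \<comment> \<open>The displacement \<open>h + \<tau> v\<close> has norm at most
    \<open>A * norm h\<close>, so tolerance \<open>e / A\<close> costs only
    \<open>e * norm h\<close>.\<close>
  define A where "A = 1 + L * norm v"
  have A: "A > 0" unfolding A_def using L by (simp add: add_pos_nonneg)
  have "e / A > 0" using e A by simp
  then obtain d where d: "d > 0"
    "\<And>x. x \<in> \<Omega> \<Longrightarrow> norm (x - p) \<le> d \<Longrightarrow> blinfun_apply f (x - p) \<le> e / A * norm (x - p)"
    using f unfolding frechet_normal_cone_def by blast
  have small: "blinfun_apply f h \<le> (L * \<eta> + e) * norm h" if h: "norm h < min \<rho> (d / A)" for h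
  proof -
    obtain \<tau> where \<tau>: "0 \<le> \<tau>" "\<tau> \<le> L * norm h" "p + h + \<tau> *\<^sub>R v \<in> \<Omega>" using move h by auto
    have "norm (h + \<tau> *\<^sub>R v) \<le> norm h + \<tau> * norm v"
      using norm_triangle_ineq[of h "\<tau> *\<^sub>R v"] \<tau>(1) by simp
    also have "\<dots> \<le> A * norm h"
      unfolding A_def using mult_right_mono[OF \<tau>(2), of "norm v"] by (simp add: algebra_simps)
    finally have n: "norm (h + \<tau> *\<^sub>R v) \<le> A * norm h" .
    also have "\<dots> \<le> d" using h A by (simp add: field_simps)
    finally have "blinfun_apply f (h + \<tau> *\<^sub>R v) \<le> e / A * norm (h + \<tau> *\<^sub>R v)"
      using d(2)[OF \<tau>(3)] by (simp add: add.assoc)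
    also have "\<dots> \<le> e / A * (A * norm h)" using n e A by (intro mult_left_mono) auto
    also have "\<dots> = e * norm h" using A by simp
    finally have "blinfun_apply f h + \<tau> * blinfun_apply f v \<le> e * norm h"
      by (simp add: blinfun.bilinear_simps)
    moreover have "\<tau> * (- blinfun_apply f v) \<le> (L * norm h) * \<eta>"
      unfolding \<eta>_def using \<tau> L by (intro order_trans[OF mult_left_mono mult_right_mono]) auto
    ultimately show ?thesis by (simp add: algebra_simps)
  qed
  \<comment> \<open>Both sides are positively homogeneous, so rescaling \<open>h\<close> to norm
    \<open>s / 2\<close> suffices.\<close>
  have all: "blinfun_apply f h \<le> (L * \<eta> + e) * norm h" for h
  proof (cases "h = 0")
    case False
    define s where "s = min \<rho> (d / A)"
    have s: "s > 0" unfolding s_def using d A \<open>\<rho> > 0\<close> by simp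
    define k where "k = s / (2 * norm h)"
    have k: "k > 0" unfolding k_def using False s by simp
    have "norm (k *\<^sub>R h) = s / 2" using False s unfolding k_def by simp
    also have "\<dots> < min \<rho> (d / A)" using s unfolding s_def[symmetric] by simp
    finally have "norm (k *\<^sub>R h) < min \<rho> (d / A)" .
    then have "blinfun_apply f (k *\<^sub>R h) \<le> (L * \<eta> + e) * norm (k *\<^sub>R h)"
      by (rule small)
    then have "k * blinfun_apply f h \<le> k * ((L * \<eta> + e) * norm h)"
      using k by (simp add: blinfun.bilinear_simps mult.left_commute)
    then show ?thesis using k by simp
  qed (simp add: blinfun.bilinear_simps)
  show "norm f \<le> L * max 0 (- blinfun_apply f v) + e"
  proof (rule norm_blinfun_bound)
    show "0 \<le> L * max 0 (- blinfun_apply f v) + e" using L e by simp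
    show "norm (blinfun_apply f h) \<le> (L * max 0 (- blinfun_apply f v) + e) * norm h" for h
      using all[of h] all[of "- h"] unfolding \<eta>_def by (simp add: blinfun.bilinear_simps abs_le_iff)
  qed
qed

lemma limiting_normal_eq_zero:
  fixes f :: "'a::real_normed_vector dual"
  assumes f: "f \<in> pos_dual {v} \<inter> limiting_normal_cone y \<Omega>" and L: "L \<ge> 0" and "\<rho> > 0"
    and move: "\<And>p h. p \<in> \<Omega> \<Longrightarrow> norm (p - y) < \<rho> \<Longrightarrow> norm h < \<rho> \<Longrightarrow>
      \<exists>\<tau>. 0 \<le> \<tau> \<and> \<tau> \<le> L * norm h \<and> p + h + \<tau> *\<^sub>R v \<in> \<Omega>"
  shows "f = 0"
proof -
  obtain x g where x: "\<And>k. x k \<in> \<Omega>" "x \<longlonglongrightarrow> y"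
    and g: "\<And>k. g k \<in> frechet_normal_cone (x k) \<Omega>" "g \<longlonglongrightarrow> f"
    using f unfolding limiting_normal_cone_def by auto
  have "eventually (\<lambda>k. norm (x k - y) < \<rho>) sequentially"
    using x(2) \<open>\<rho> > 0\<close> by (auto simp: tendsto_iff dist_norm)
  then have ev: "eventually (\<lambda>k. norm (g k) \<le> L * max 0 (- blinfun_apply (g k) v)) sequentially"
    by (rule eventually_mono) (use frechet_normal_norm_le[OF g(1) L \<open>\<rho> > 0\<close>] move x(1) in blast)
  have "(\<lambda>k. L * max 0 (- blinfun_apply (g k) v)) \<longlonglongrightarrow> L * max 0 (- blinfun_apply f v)"
    by (intro tendsto_intros g(2))
  then have "norm f \<le> L * max 0 (- blinfun_apply f v)"
    using tendsto_le[OF sequentially_bot _ tendsto_norm[OF g(2)] ev] by blast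
  moreover have "max 0 (- blinfun_apply f v) = 0" using f by (simp add: pos_dual_def)
  ultimately show "f = 0" by simp
qed

lemma lipschitz_aroundE:
  assumes "lipschitz_around f a"
  obtains L \<rho> where "L \<ge> 0" and "\<rho> > 0" and "\<And>x. norm (x - a) < \<rho> \<Longrightarrow> \<bar>f x\<bar> \<noteq> \<infinity>"
    and "\<And>x y. norm (x - a) < \<rho> \<Longrightarrow> norm (y - a) < \<rho> \<Longrightarrow>
           real_of_ereal (f x) - real_of_ereal (f y) \<le> L * norm (x - y)"
proof -
  obtain L U where LU: "L \<ge> 0" "open U" "a \<in> U" "\<forall>x\<in>U. \<bar>f x\<bar> \<noteq> \<infinity>"
    "\<forall>x\<in>U. \<forall>y\<in>U. \<bar>real_of_ereal (f x) - real_of_ereal (f y)\<bar> \<le> L * norm (x - y)"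
    using assms unfolding lipschitz_around_def by (elim exE conjE) (rule that)
  obtain \<rho> where \<rho>: "\<rho> > 0" "ball a \<rho> \<subseteq> U" using LU(2,3) openE by blast
  have "x \<in> U" if "norm (x - a) < \<rho>" for x
    using \<rho>(2) that by (auto simp: dist_norm norm_minus_commute)
  note in_U = this
  show thesis
  proof (rule that[OF LU(1) \<rho>(1)])
    show "\<bar>f x\<bar> \<noteq> \<infinity>" if "norm (x - a) < \<rho>" for x
      using LU(4) in_U[OF that] by (rule bspec)
    show "real_of_ereal (f x) - real_of_ereal (f y) \<le> L * norm (x - y)"
      if "norm (x - a) < \<rho>" "norm (y - a) < \<rho>" for x y
      using LU(5)[rule_format, OF in_U[OF that(1)] in_U[OF that(2)]] by (rule abs_le_D1)
  qed
qed

text \<open>Tracing \<open>p\<close> back to \<open>y = p - t0 v\<close> near \<open>a\<close> gives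
  a point of minimal time at most \<open>t0\<close>; the Lipschitz bound then controls the time from
  \<open>y + h\<close>. The net shift \<open>t - t0\<close> may be negative.\<close>

lemma min_time_lipschitz_shift:
  assumes cl: "closed \<Omega>" and t0: "0 \<le> t0"
    and lip: "lipschitz_around (min_time \<Omega> v) a"
  obtains L \<rho> where "L \<ge> 0" and "\<rho> > 0"
    and "\<And>p h. p \<in> \<Omega> \<Longrightarrow> norm (p - (a + t0 *\<^sub>R v)) < \<rho> \<Longrightarrow> norm h < \<rho> \<Longrightarrow>
      \<exists>t. 0 \<le> t \<and> t \<le> t0 + L * norm h \<and> p + h + (t - t0) *\<^sub>R v \<in> \<Omega>"
proof -
  obtain L \<rho> where L: "L \<ge> 0" and \<rho>: "\<rho> > 0"
    and fin: "\<And>x. norm (x - a) < \<rho> \<Longrightarrow> \<bar>min_time \<Omega> v x\<bar> \<noteq> \<infinity>"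
    and lip: "\<And>x y. norm (x - a) < \<rho> \<Longrightarrow> norm (y - a) < \<rho> \<Longrightarrow>
       real_of_ereal (min_time \<Omega> v x) - real_of_ereal (min_time \<Omega> v y) \<le> L * norm (x - y)"
    by (rule lipschitz_aroundE[OF lip]) (rule that)
  \<comment> \<open>Halving the radius keeps both \<open>y\<close> and \<open>y + h\<close> within
    \<open>\<rho>\<close> of \<open>a\<close>.\<close>
  have "\<exists>t. 0 \<le> t \<and> t \<le> t0 + L * norm h \<and> p + h + (t - t0) *\<^sub>R v \<in> \<Omega>"
    if p: "p \<in> \<Omega>" "norm (p - (a + t0 *\<^sub>R v)) < \<rho> / 2" and h: "norm h < \<rho> / 2" for p h
  proof -
    define y where "y = p - t0 *\<^sub>R v"
    have ya: "norm (y - a) < \<rho> / 2" using p(2) unfolding y_def by (simp add: algebra_simps)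
    have yh: "norm (y + h - a) < \<rho>"
      using norm_triangle_ineq[of "y - a" h] ya h by (simp add: algebra_simps)
    have "min_time \<Omega> v y \<le> ereal t0" using t0 p(1) unfolding y_def by (intro min_time_le) auto
    then have ty: "real_of_ereal (min_time \<Omega> v y) \<le> t0"
      using fin[of y] ya \<rho> by (cases "min_time \<Omega> v y") auto
    have "y + h \<in> eff_dom (min_time \<Omega> v)" using fin[OF yh] by (auto simp: eff_dom_def)
    then obtain t where t: "0 \<le> t" "min_time \<Omega> v (y + h) = ereal t" "y + h + t *\<^sub>R v \<in> \<Omega>"
      by (rule min_time_attained[OF cl]) (rule that)
    have "t - real_of_ereal (min_time \<Omega> v y) \<le> L * norm h"
      using lip[of "y + h" y] yh ya \<rho> t(2) by simp
    moreover have "p + h + (t - t0) *\<^sub>R v = y + h + t *\<^sub>R v"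
      unfolding y_def by (simp add: algebra_simps)
    ultimately show ?thesis using t ty by (intro exI[of _ t] conjI) (linarith, linarith, simp only:)
  qed
  then show thesis using L \<rho> by (intro that[of L "\<rho> / 2"]) auto
qed

section \<open>The cases of a starting point inside and outside the set\<close>

theorem theorem4p7:
  fixes \<Omega> :: "'a::real_normed_vector set" and v xbar :: 'a
  assumes "finite_dimensional TYPE('a)"
    and "\<Omega> \<noteq> {}" and "closed \<Omega>"
    and "v \<noteq> 0"
    and "xbar \<in> eff_dom (min_time \<Omega> v)"
  shows "(xbar \<in> \<Omega> \<longrightarrow>
            (lipschitz_around (min_time \<Omega> v) xbar \<longleftrightarrow>
             pos_dual {v} \<inter> limiting_normal_cone xbar \<Omega> = {0})) \<and>
         (xbar \<notin> \<Omega> \<longrightarrow>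
            (let xt = xbar + real_of_ereal (min_time \<Omega> v xbar) *\<^sub>R v in
              (pos_dual {v} \<inter> limiting_normal_cone xt \<Omega> = {0} \<longrightarrow>
                 lipschitz_around (min_time \<Omega> v) xbar) \<and>
              (v \<in> recession_cone \<Omega> \<longrightarrow> lipschitz_around (min_time \<Omega> v) xbar \<longrightarrow>
                 pos_dual {v} \<inter> limiting_normal_cone xt \<Omega> = {0})))"
proof -
  obtain t0 where t0: "0 \<le> t0" "min_time \<Omega> v xbar = ereal t0" "xbar + t0 *\<^sub>R v \<in> \<Omega>"
    by (rule min_time_attained[OF assms(3,5)]) (rule that)
  have suff: "lipschitz_around (min_time \<Omega> v) xbar"
    if "pos_dual {v} \<inter> limiting_normal_cone (xbar + t0 *\<^sub>R v) \<Omega> = {0}"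
    using that by (intro lipschitz_around_min_time[OF assms(1,3) t0]) simp
  \<comment> \<open>The disjunction treats both parts at once: \<open>t0 = 0\<close> when
    \<open>xbar\<close> lies in the set, a recession direction otherwise.\<close>
  have nec: "pos_dual {v} \<inter> limiting_normal_cone (xbar + t0 *\<^sub>R v) \<Omega> = {0}"
    if lip: "lipschitz_around (min_time \<Omega> v) xbar" and or: "t0 = 0 \<or> v \<in> recession_cone \<Omega>"
  proof -
    obtain L \<rho> where L: "L \<ge> 0" and \<rho>: "\<rho> > 0"
      and shift: "\<And>p h. p \<in> \<Omega> \<Longrightarrow> norm (p - (xbar + t0 *\<^sub>R v)) < \<rho> \<Longrightarrow> norm h < \<rho> \<Longrightarrow>
        \<exists>t. 0 \<le> t \<and> t \<le> t0 + L * norm h \<and> p + h + (t - t0) *\<^sub>R v \<in> \<Omega>"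
      by (rule min_time_lipschitz_shift[OF assms(3) t0(1) lip]) (rule that)
    have "\<exists>\<tau>. 0 \<le> \<tau> \<and> \<tau> \<le> L * norm h \<and> p + h + \<tau> *\<^sub>R v \<in> \<Omega>"
      if ph: "p \<in> \<Omega>" "norm (p - (xbar + t0 *\<^sub>R v)) < \<rho>" "norm h < \<rho>" for p h
    proof -
      obtain t where t: "0 \<le> t" "t \<le> t0 + L * norm h" "p + h + (t - t0) *\<^sub>R v \<in> \<Omega>"
        using shift[OF ph] by blast
      show ?thesis
      proof (cases "t0 = 0")
        case True
        then show ?thesis using t by (intro exI[of _ t]) auto
      next
        case False
        then have "v \<in> recession_cone \<Omega>" using or by simp
        \<comment> \<open>The net shift \<open>t - t0\<close> may point against \<open>v\<close>;
          moving on along the recession direction brings it to exactly \<open>L * norm h\<close>,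
          which is nonnegative.\<close>
        then have "p + h + (t - t0) *\<^sub>R v + (t0 + L * norm h - t) *\<^sub>R v \<in> \<Omega>"
          using t unfolding recession_cone_def by simp
        moreover have "p + h + (t - t0) *\<^sub>R v + (t0 + L * norm h - t) *\<^sub>R v = p + h + (L * norm h) *\<^sub>R v"
          by (simp add: algebra_simps)
        ultimately show ?thesis using L by (intro exI[of _ "L * norm h"]) auto
      qed
    qed
    then have "pos_dual {v} \<inter> limiting_normal_cone (xbar + t0 *\<^sub>R v) \<Omega> \<subseteq> {0}"
      using limiting_normal_eq_zero[OF _ L \<rho>] by blast
    then show ?thesis using zero_in_pos_dual_limiting_normal_cone[OF t0(3), of "{v}"] by blast
  qed
  have "t0 = 0" if "xbar \<in> \<Omega>"
    using min_time_le[of 0 xbar v \<Omega>] that t0 by simp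
  then have "xbar \<in> \<Omega> \<longrightarrow> (lipschitz_around (min_time \<Omega> v) xbar \<longleftrightarrow>
      pos_dual {v} \<inter> limiting_normal_cone xbar \<Omega> = {0})"
    using suff nec by fastforce
  moreover have "real_of_ereal (min_time \<Omega> v xbar) = t0" by (simp add: t0(2))
  ultimately show ?thesis unfolding Let_def using suff nec by simp
qed

end
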